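(* Let $f:\mathbf N\to\mathbf N$ be a non-decreasing divergent function, and let $\Gamma$ be a graph picked uniformly at random in $\mathcal G^{N,f(N)}$. Then: (1) If $f(N)\succ N^{3/2}$, then $A_\Gamma$ is asymptotically almost surely $2$-dimensional. (2) If $f(N)\prec N^{3/2}$, then $A_\Gamma$ is asymptotically almost surely not $2$-dimensional.
   Context: A defining graph $\Gamma$ is a finite simplicial graph with vertex set $V(\Gamma)$, each edge $e_{ab}$ carrying a coefficient $m_{ab}\in\{2,3,\dots\}$; if $a\neq b$ are not joined by an edge, set $m_{ab}:=\infty$. It defines the Artin group $A_\Gamma=\langle V(\Gamma)\mid \underbrace{aba\cdots}_{m_{ab}}=\underbrace{bab\cdots}_{m_{ab}}$ for every edge $e_{ab}\rangle$. For $N\ge 1$, $M\ge 2$, $\mathcal G^{N,M}$ is the finite set of all defining graphs on a fixed set of $N$ vertices with coefficients in $\{\infty,2,3,\dots,M\}$ (so $\#\mathcal G^{N,M}=M^{N(N-1)/2}$). A property holds asymptotically almost surely if the proportion of graphs $\Gamma\in\mathcal G^{N,f(N)}$ having it tends to $1$ as $N\to\infty$. $f\succ g$ means $\lim_{N\to\infty}f(N)/g(N)=\infty$, and $f\prec g$ means $g\succ f$. Divergent means $f(N)\to\infty$. $A_\Gamma$ is $2$-dimensional if for every three distinct $a,b,c\in V(\Gamma)$ the full subgraph $\Gamma'$ spanned by $a,b,c$ gives a non-spherical Artin group $A_{\Gamma'}$ (i.e. its associated Coxeter group is infinite); equivalently, $\frac1{m_{ab}}+\frac1{m_{ac}}+\frac1{m_{bc}}\le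 1$ for all such triples, with $1/\infty=0$. *)

theory Defs
  imports Complex_Main "HOL-Algebra.Group"
begin

section \<open>Groups given by generators and relations\<close>

text \<open>The letter \<open>(x, True)\<close> stands for the generator \<open>x\<close>, the letter \<open>(x, False)\<close> for its
  formal inverse.\<close>

type_synonym 'a gword = "('a \<times> bool) list"

abbreviation gwords :: "'a set \<Rightarrow> 'a gword set" where
  "gwords S \<equiv> lists (S \<times> UNIV)"

text \<open>A relation \<open>u = v\<close> between words is a pair \<open>(u, v)\<close>; \<open>pres_eq S R u v\<close> says that \<open>u\<close> and
  \<open>v\<close> represent the same element of the group \<open>\<langle>S | R\<rangle>\<close>.\<close>

inductive pres_eq :: "'a set \<Rightarrow> ('a gword \<times> 'a gword) set \<Rightarrow> 'a gword \<Rightarrow> 'a gword \<Rightarrow> bool"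
  for S R where
  refl: "w \<in> gwords S \<Longrightarrow> pres_eq S R w w"
| sym: "pres_eq S R u v \<Longrightarrow> pres_eq S R v u"
| trans: "pres_eq S R u v \<Longrightarrow> pres_eq S R v w \<Longrightarrow> pres_eq S R u w"
| cong: "pres_eq S R u v \<Longrightarrow> p \<in> gwords S \<Longrightarrow> q \<in> gwords S \<Longrightarrow> pres_eq S R (p @ u @ q) (p @ v @ q)"
| cancel: "x \<in> S \<Longrightarrow> pres_eq S R [(x, b), (x, \<not> b)] []"
| relation: "(u, v) \<in> R \<Longrightarrow> u \<in> gwords S \<Longrightarrow> v \<in> gwords S \<Longrightarrow> pres_eq S R u v"

definition pres_rel :: "'a set \<Rightarrow> ('a gword \<times> 'a gword) set \<Rightarrow> ('a gword \<times> 'a gword) set" where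
  "pres_rel S R = {(u, v). pres_eq S R u v}"

definition presented_group :: "'a set \<Rightarrow> ('a gword \<times> 'a gword) set \<Rightarrow> 'a gword set monoid" where
  "presented_group S R =
     \<lparr>carrier = gwords S // pres_rel S R,
      monoid.mult = (\<lambda>A B. \<Union>u\<in>A. \<Union>v\<in>B. pres_rel S R `` {u @ v}),
      one = pres_rel S R `` {[]}\<rparr>"

lemma pres_eq_gwords: "pres_eq S R u v \<Longrightarrow> u \<in> gwords S \<and> v \<in> gwords S"
  by (induction rule: pres_eq.induct) auto

lemma equiv_pres_rel: "equiv (gwords S) (pres_rel S R)"
proof (rule equivI)
  show "pres_rel S R \<subseteq> gwords S \<times> gwords S"
    unfolding pres_rel_def using pres_eq_gwords by blast
  show "refl_on (gwords S) (pres_rel S R)"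
    unfolding refl_on_def pres_rel_def by (blast intro: pres_eq.refl)
  show "Relation.sym (pres_rel S R)"
    unfolding sym_def pres_rel_def by (blast intro: pres_eq.sym)
  show "Relation.trans (pres_rel S R)"
    unfolding trans_def pres_rel_def by (blast intro: pres_eq.trans)
qed

lemma pres_eq_append:
  assumes "pres_eq S R u u'" "pres_eq S R v v'"
  shows "pres_eq S R (u @ v) (u' @ v')"
proof -
  have "pres_eq S R ([] @ u @ v) ([] @ u' @ v)"
    using assms pres_eq_gwords by (intro pres_eq.cong) blast+
  moreover have "pres_eq S R (u' @ v @ []) (u' @ v' @ [])"
    using assms pres_eq_gwords by (intro pres_eq.cong) blast+
  ultimately show ?thesis
    by (auto intro: pres_eq.trans)
qed

lemma presented_group_mult:
  assumes "u \<in> gwords S" "v \<in> gwords S"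
  shows "(pres_rel S R `` {u}) \<otimes>\<^bsub>presented_group S R\<^esub> (pres_rel S R `` {v}) = pres_rel S R `` {u @ v}"
proof -
  have "congruent2 (pres_rel S R) (pres_rel S R) (\<lambda>u v. pres_rel S R `` {u @ v})"
  proof (rule congruent2I')
    fix u u' v v' assume "(u, u') \<in> pres_rel S R" "(v, v') \<in> pres_rel S R"
    then have "(u @ v, u' @ v') \<in> pres_rel S R"
      unfolding pres_rel_def by (auto intro: pres_eq_append)
    then show "pres_rel S R `` {u @ v} = pres_rel S R `` {u' @ v'}"
      by (rule equiv_class_eq[OF equiv_pres_rel])
  qed
  then show ?thesis
    unfolding presented_group_def
    using UN_equiv_class2[OF equiv_pres_rel equiv_pres_rel _ assms] by simp
qed

lemma pres_eq_inverse:
  assumes "w \<in> gwords S"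
  shows "pres_eq S R (rev (map (\<lambda>(x, b). (x, \<not> b)) w) @ w) []"
  using assms
proof (induction w rule: list.induct)
  case Nil
  then show ?case by (auto intro: pres_eq.refl)
next
  case (Cons l w)
  obtain x b where l: "l = (x, b)" by force
  let ?w' = "rev (map (\<lambda>(x, b). (x, \<not> b)) w)"
  have x: "x \<in> S" and w: "w \<in> gwords S" using Cons.prems l by (simp_all only: Cons_in_lists_iff mem_Sigma_iff)
  then have w': "?w' \<in> gwords S" by (auto simp: in_lists_conv_set split: prod.splits)
  have "pres_eq S R (?w' @ [(x, \<not> b), (x, \<not> \<not> b)] @ w) (?w' @ [] @ w)"
    by (intro pres_eq.cong pres_eq.cancel x w w')
  then have "pres_eq S R (?w' @ [(x, \<not> b), (x, b)] @ w) (?w' @ w)" by simp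
  then have "pres_eq S R (?w' @ [(x, \<not> b), (x, b)] @ w) []"
    using Cons.IH[OF w] by (rule pres_eq.trans)
  then show ?case by (simp add: l)
qed

lemma group_presented_group: "group (presented_group S R)"
proof (rule groupI)
  let ?G = "presented_group S R" and ?c = "\<lambda>u. pres_rel S R `` {u}"
  have car: "carrier ?G = ?c ` gwords S"
    by (auto simp: presented_group_def quotient_def)
  have one: "\<one>\<^bsub>?G\<^esub> = ?c []" by (simp add: presented_group_def)
  show "\<one>\<^bsub>?G\<^esub> \<in> carrier ?G" unfolding car one by (intro imageI lists.Nil)
  show "x \<otimes>\<^bsub>?G\<^esub> y \<in> carrier ?G" if "x \<in> carrier ?G" "y \<in> carrier ?G" for x y
  proof -
    from that obtain u v where uv: "u \<in> gwords S" "v \<in> gwords S" "x = ?c u" "y = ?c v"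
      unfolding car by (elim imageE)
    then have "u @ v \<in> gwords S" by (simp only: append_in_lists_conv)
    then show ?thesis
      unfolding car uv(3,4) presented_group_mult[OF uv(1,2)] by (rule imageI)
  qed
  show "x \<otimes>\<^bsub>?G\<^esub> y \<otimes>\<^bsub>?G\<^esub> z = x \<otimes>\<^bsub>?G\<^esub> (y \<otimes>\<^bsub>?G\<^esub> z)"
    if xyz: "x \<in> carrier ?G" "y \<in> carrier ?G" "z \<in> carrier ?G" for x y z
  proof -
    from xyz obtain u v w where "u \<in> gwords S" "v \<in> gwords S" "w \<in> gwords S"
      "x = ?c u" "y = ?c v" "z = ?c w"
      unfolding car by (elim imageE)
    then show ?thesis by (simp add: presented_group_mult)
  qed
  show "\<one>\<^bsub>?G\<^esub> \<otimes>\<^bsub>?G\<^esub> x = x" if x: "x \<in> carrier ?G" for x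
  proof -
    from x obtain u where "u \<in> gwords S" "x = ?c u" unfolding car by (elim imageE)
    then show ?thesis by (simp add: one presented_group_mult)
  qed
  show "\<exists>y\<in>carrier ?G. y \<otimes>\<^bsub>?G\<^esub> x = \<one>\<^bsub>?G\<^esub>" if x: "x \<in> carrier ?G" for x
  proof -
    from x obtain u where u: "u \<in> gwords S" and xu: "x = ?c u" unfolding car by (elim imageE)
    let ?v = "rev (map (\<lambda>(x, b). (x, \<not> b)) u)"
    have v: "?v \<in> gwords S" using u by (auto simp: in_lists_conv_set split: prod.splits)
    have "(?v @ u, []) \<in> pres_rel S R"
      unfolding pres_rel_def using pres_eq_inverse[OF u] by simp
    then have "?c (?v @ u) = ?c []" by (rule equiv_class_eq[OF equiv_pres_rel])
    then have "?c ?v \<otimes>\<^bsub>?G\<^esub> x = \<one>\<^bsub>?G\<^esub>"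
      using u v xu by (simp add: one presented_group_mult del: rev_map)
    moreover have "?c ?v \<in> carrier ?G" unfolding car using v by (rule imageI)
    ultimately show ?thesis by blast
  qed
qed


section \<open>Defining graphs, Artin groups and Coxeter groups\<close>

text \<open>The edges are the two-element sets in the domain of \<open>coef\<close>; the convention
  \<open>m\<^sub>a\<^sub>b = \<infinity>\<close> for distinct non-adjacent \<open>a, b\<close> is \<open>coef \<Gamma> {a, b} = None\<close>.\<close>

record 'a dgraph =
  verts :: "'a set"
  coef :: "'a set \<rightharpoonup> nat"

definition defining_graph :: "'a dgraph \<Rightarrow> bool" where
  "defining_graph \<Gamma> \<longleftrightarrow>
     finite (verts \<Gamma>) \<and> dom (coef \<Gamma>) \<subseteq> {e. e \<subseteq> verts \<Gamma> \<and> card e = 2} \<and> ran (coef \<Gamma>) \<subseteq> {2..}"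

definition full_subgraph :: "'a dgraph \<Rightarrow> 'a set \<Rightarrow> 'a dgraph" where
  "full_subgraph \<Gamma> W = \<lparr>verts = W, coef = coef \<Gamma> |` Pow W\<rparr>"

text \<open>The word \<open>abab\<dots>\<close> with \<open>m\<close> letters.\<close>

primrec alternating :: "nat \<Rightarrow> 'a \<Rightarrow> 'a \<Rightarrow> 'a gword" where
  "alternating 0 a b = []"
| "alternating (Suc m) a b = (a, True) # alternating m b a"

definition artin_relations :: "'a dgraph \<Rightarrow> ('a gword \<times> 'a gword) set" where
  "artin_relations \<Gamma> = {(alternating m a b, alternating m b a) | a b m. coef \<Gamma> {a, b} = Some m}"

definition artin_group :: "'a dgraph \<Rightarrow> 'a gword set monoid" where
  "artin_group \<Gamma> = presented_group (verts \<Gamma>) (artin_relations \<Gamma>)"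

text \<open>The associated Coxeter group: the quotient of the Artin group by the squares of the standard
  generators.\<close>

definition coxeter_group :: "'a dgraph \<Rightarrow> 'a gword set monoid" where
  "coxeter_group \<Gamma> =
     presented_group (verts \<Gamma>)
       (artin_relations \<Gamma> \<union> {([(a, True), (a, True)], []) | a. a \<in> verts \<Gamma>})"

text \<open>Being spherical and being two-dimensional are properties of the Artin group together with its
  standard presentation, so they are stated for the defining graph.\<close>

definition spherical :: "'a dgraph \<Rightarrow> bool" where
  "spherical \<Gamma> \<longleftrightarrow> finite (carrier (coxeter_group \<Gamma>))"

definition two_dimensional :: "'a dgraph \<Rightarrow> bool" where
  "two_dimensional \<Gamma> \<longleftrightarrow>
     (\<forall>a\<in>verts \<Gamma>. \<forall>b\<in>verts \<Gamma>. \<forall>c\<in>verts \<Gamma>.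
        a \<noteq> b \<and> a \<noteq> c \<and> b \<noteq> c \<longrightarrow> \<not> spherical (full_subgraph \<Gamma> {a, b, c}))"


section \<open>Random defining graphs\<close>

text \<open>For \<open>M < 2\<close> the set of graphs still contains the edgeless graph; a divergent \<open>f\<close> takes such
  values only finitely often.\<close>

definition graphs :: "nat \<Rightarrow> nat \<Rightarrow> nat dgraph set" where
  "graphs N M = {\<Gamma>. defining_graph \<Gamma> \<and> verts \<Gamma> = {..<N} \<and> ran (coef \<Gamma>) \<subseteq> {2..M}}"

definition asymptotically_almost_surely :: "(nat \<Rightarrow> nat) \<Rightarrow> (nat dgraph \<Rightarrow> bool) \<Rightarrow> bool" where
  "asymptotically_almost_surely f P \<longleftrightarrow>
     (\<lambda>N. real (card {\<Gamma> \<in> graphs N (f N). P \<Gamma>}) / real (card (graphs N (f N)))) \<longlonglongrightarrow> 1"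

definition dominates :: "(nat \<Rightarrow> real) \<Rightarrow> (nat \<Rightarrow> real) \<Rightarrow> bool" where
  "dominates f g \<longleftrightarrow> filterlim (\<lambda>N. f N / g N) at_top sequentially"

abbreviation (input) dominated_by :: "(nat \<Rightarrow> real) \<Rightarrow> (nat \<Rightarrow> real) \<Rightarrow> bool" where
  "dominated_by f g \<equiv> dominates g f"

lemma card_maps:
  assumes "finite E" "finite A"
  shows "card {c. dom c \<subseteq> E \<and> ran c \<subseteq> A} = Suc (card A) ^ card E"
proof -
  let ?F = "{c. dom c \<subseteq> E \<and> ran c \<subseteq> A}" and ?P = "E \<rightarrow>\<^sub>E insert None (Some ` A)"
  have "bij_betw (\<lambda>c. restrict c E) ?F ?P"
  proof (rule bij_betw_byWitness[where f' = "\<lambda>g e. if e \<in> E then g e else None"])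
    show "\<forall>c\<in>?F. (\<lambda>e. if e \<in> E then restrict c E e else None) = c"
    proof (intro ballI ext)
      fix c e assume "c \<in> ?F"
      then show "(if e \<in> E then restrict c E e else None) = c e"
        by (cases "c e") (auto dest: domI)
    qed
    show "\<forall>g\<in>?P. restrict (\<lambda>e. if e \<in> E then g e else None) E = g"
    proof (intro ballI ext)
      fix g e assume "g \<in> ?P"
      then show "restrict (\<lambda>e. if e \<in> E then g e else None) E e = g e"
        by (cases "e \<in> E") (simp_all add: PiE_arb[of g E])
    qed
    show "(\<lambda>c. restrict c E) ` ?F \<subseteq> ?P"
    proof (intro image_subsetI PiE_I)
      fix c e assume "c \<in> ?F" "e \<in> E"
      then show "restrict c E e \<in> insert None (Some ` A)"
        by (cases "c e") (auto simp: ran_def)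
    qed simp
    show "(\<lambda>g e. if e \<in> E then g e else None) ` ?P \<subseteq> ?F"
    proof (intro image_subsetI CollectI conjI)
      fix g assume g: "g \<in> ?P"
      show "dom (\<lambda>e. if e \<in> E then g e else None) \<subseteq> E"
        by (auto split: if_splits)
      show "ran (\<lambda>e. if e \<in> E then g e else None) \<subseteq> A"
      proof
        fix y assume "y \<in> ran (\<lambda>e. if e \<in> E then g e else None)"
        then obtain e where "e \<in> E" "g e = Some y"
          by (auto simp: ran_def split: if_splits)
        then show "y \<in> A" using PiE_mem[OF g] by force
      qed
    qed
  qed
  then have "card ?F = card ?P" by (rule bij_betw_same_card)
  also have "\<dots> = Suc (card A) ^ card E"
    using assms by (simp add: card_PiE card_insert_if card_image image_iff)
  finally show ?thesis .
qed

lemma card_graphs: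
  assumes "M \<ge> 1"
  shows "card (graphs N M) = M ^ (N * (N - 1) div 2)"
proof -
  define E where "E = {e. e \<subseteq> {..<N} \<and> card e = 2}"
  have "{2..M} \<subseteq> {2..}" by auto
  then have graphs: "graphs N M = {\<Gamma>. verts \<Gamma> = {..<N} \<and> dom (coef \<Gamma>) \<subseteq> E \<and> ran (coef \<Gamma>) \<subseteq> {2..M}}"
    unfolding graphs_def defining_graph_def E_def by auto
  have "bij_betw coef (graphs N M) {c. dom c \<subseteq> E \<and> ran c \<subseteq> {2..M}}"
    unfolding graphs
    by (rule bij_betw_byWitness[where f' = "\<lambda>c. \<lparr>verts = {..<N}, coef = c\<rparr>"])
       (simp_all add: image_subset_iff)
  moreover have "finite E"
    unfolding E_def by (rule finite_subset[of _ "Pow {..<N}"]) auto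
  ultimately have "card (graphs N M) = M ^ card E"
    using card_maps[of E "{2..M}"] assms by (simp add: bij_betw_same_card)
  also have "card E = N * (N - 1) div 2"
    using n_subsets[of "{..<N}" 2] by (simp add: E_def choose_two)
  finally show ?thesis .
qed

end

theory Submission
  imports Defs
begin

text \<open>
  A triangle of a defining graph spans a finite Coxeter group only if two of its labels are small,
  and it certainly does if two of its labels equal 2 and the third one is finite. In a random graph
  whose \<open>M\<close> labels are independent and uniform, a given triangle has either property with
  probability of order \<open>1 / M\<^sup>2\<close>. As there are about \<open>N\<^sup>3\<close> triangles, the expected number of spherical
  ones is of order \<open>N\<^sup>3 / M\<^sup>2\<close>, and \<open>M = N\<^bsup>3/2\<^esup>\<close> is the threshold.

  Above the threshold the expectation tends to 0, and a union bound suffices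
  (\<open>proportion_not_two_dimensional_le\<close>). What it needs from group theory is
  \<open>not_spherical_if_two_large\<close>: if the two edges at some vertex of a triangle carry labels at least 6
  or \<open>\<infinity>\<close>, the Coxeter group is infinite. The dual of the geometric representation shows
  this: a Coxeter element, applied over and over, makes one coordinate grow for ever.

  Below the threshold the expectation tends to infinity, and one has to show that the number of
  spherical triangles is concentrated. This is a second moment computation (\<open>second_moment\<close>) for
  triangles with labels \<open>2, 2, m\<close>, whose Coxeter group, dihedral times \<open>\<int>/2\<close>, is finite by
  \<open>spherical_2_2_m\<close>. Only triangles with one vertex in each of three disjoint blocks of
  \<open>N div 3\<close> vertices are counted, and the vertex between the two labels 2 always lies in the first
  block. Then an edge plays the same part in every counted triangle that contains it, and the
  correlations of two triangles can be read off from the edges that they share.\<close>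

section \<open>Infinite Coxeter groups of triangles\<close>

text \<open>The negative of the Cartan matrix \<open>2 B\<close> of the geometric representation. The value \<open>-2\<close> on the
  diagonal makes a single formula in \<open>fire\<close> cover the fired vertex as well as the others.\<close>

definition weight :: "'a dgraph \<Rightarrow> 'a \<Rightarrow> 'a \<Rightarrow> real" where
  "weight \<Gamma> x y =
     (if x = y then -2 else case coef \<Gamma> {x, y} of None \<Rightarrow> 2 | Some m \<Rightarrow> 2 * cos (pi / real m))"

text \<open>The move of Mozes' numbers game: the value at \<open>x\<close> changes sign and is passed on to the other
  vertices with weights \<open>K\<close>. This is how the generator \<open>x\<close> acts in the dual of the geometric
  representation. Working with the dual avoids matrices: a state is just a function on vertices.\<close>

definition fire :: "('a \<Rightarrow> 'a \<Rightarrow> real) \<Rightarrow> 'a \<Rightarrow> ('a \<Rightarrow> real) \<Rightarrow> 'a \<Rightarrow> real" where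
  "fire K x v = (\<lambda>y. v y + K x y * v x)"

definition act :: "('a \<Rightarrow> 'a \<Rightarrow> real) \<Rightarrow> 'a gword \<Rightarrow> ('a \<Rightarrow> real) \<Rightarrow> 'a \<Rightarrow> real" where
  "act K w = fold (\<lambda>l. fire K (fst l)) w"

lemma act_simps [simp]:
  "act K [] v = v"
  "act K (l # w) v = act K w (fire K (fst l) v)"
  "act K (u @ w) v = act K w (act K u v)"
  by (simp_all add: act_def)

lemma fire_fire: "K x x = -2 \<Longrightarrow> fire K x (fire K x v) = v"
  by (auto simp: fire_def algebra_simps)

lemma act_alternating_invariant:
  assumes "\<And>v. I (fire K a v) = I v" "\<And>v. I (fire K b v) = I v"
  shows "I (act K (alternating n a b) v) = I v"
  using assms by (induction n arbitrary: a b v) simp_all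

text \<open>The values at \<open>a\<close> and \<open>b\<close> are those of a point of the plane in polar coordinates \<open>r, \<phi>\<close>. Firing
  \<open>a\<close> reflects the point in one of two lines with angle \<open>\<theta>\<close>. When the roles of \<open>a\<close> and \<open>b\<close> are then
  exchanged, the result has the same shape with \<open>\<phi> + \<theta>\<close> in place of \<open>\<phi>\<close>, so an alternating word only adds
  multiples of \<open>\<theta>\<close> to the angle.\<close>

lemma act_alternating_plane:
  assumes "a \<noteq> b" "K a a = -2" "K b b = -2" "K a b = 2 * cos \<theta>" "K b a = 2 * cos \<theta>"
    and "v a = r * sin \<phi>" "v b = r * sin (\<theta> - \<phi>)"
  shows "act K (alternating n a b) v (if even n then a else b) = r * sin (\<phi> + n * \<theta>) \<and>
         act K (alternating n a b) v (if even n then b else a) = r * sin (\<theta> - (\<phi> + n * \<theta>))"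
  using assms
proof (induction n arbitrary: a b \<phi> v)
  case 0
  then show ?case by simp
next
  case (Suc n)
  have a: "fire K a v a = r * sin (\<theta> - (\<theta> + \<phi>))"
    using Suc.prems by (simp add: fire_def)
  have b: "fire K a v b = r * sin (\<theta> + \<phi>)"
    using Suc.prems by (simp add: fire_def sin_diff sin_add algebra_simps)
  have e: "\<phi> + Suc n * \<theta> = \<theta> + \<phi> + n * \<theta>" by (simp add: algebra_simps)
  show ?case
    unfolding e using Suc.IH[of b a "fire K a v" "\<theta> + \<phi>"] Suc.prems(1-5) a b
    by (cases "even n") simp_all
qed

text \<open>After \<open>m\<close> steps the angle has grown by \<open>\<pi>\<close>, so both words send the plane coordinates to their
  negatives (exchanged if \<open>m\<close> is odd). Every other coordinate becomes invariant under
  \<open>a\<close> and \<open>b\<close> after a suitable combination of the two plane coordinates is added to it, because the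
  form is non-degenerate on the plane. So it too ends up with the same value under both words.\<close>

lemma braid_relation:
  assumes "a \<noteq> b" "K a a = -2" "K b b = -2"
    and "K a b = 2 * cos (pi / real m)" "K b a = 2 * cos (pi / real m)" "m \<ge> 2"
  shows "act K (alternating m a b) = act K (alternating m b a)"
proof (intro ext)
  fix v :: "'a \<Rightarrow> real" and y
  define \<theta> where "\<theta> = pi / real m"
  have m\<theta>: "m * \<theta> = pi" using assms(6) by (simp add: \<theta>_def)
  have "0 < \<theta>" "\<theta> < pi" using assms(6) by (auto simp: \<theta>_def field_simps)
  then have sin: "sin \<theta> > 0" by (rule sin_gt_zero)
  obtain r \<phi> where r: "(v b + v a * cos \<theta>) / sin \<theta> = r * cos \<phi>" "v a = r * sin \<phi>"
    using polar_Ex by blast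
  have vb: "v b = r * sin (\<theta> - \<phi>)"
    using sin r by (simp add: sin_diff field_simps)
  have va: "v a = r * sin (\<theta> - (\<theta> - \<phi>))" using r by simp
  let ?u = "act K (alternating m a b) v" and ?w = "act K (alternating m b a) v"
  have s: "sin (\<theta> - (\<psi> + pi)) = - sin (\<theta> - \<psi>)" for \<psi>
    by (simp add: diff_add_eq_diff_diff_swap sin_diff cos_diff)
  have u: "?u (if even m then a else b) = - v a" "?u (if even m then b else a) = - v b"
    using act_alternating_plane[of a b K \<theta> v r \<phi> m] assms r(2) vb
    by (simp_all add: m\<theta> s flip: \<theta>_def)
  have w: "?w (if even m then b else a) = - v b" "?w (if even m then a else b) = - v a"
    using act_alternating_plane[of b a K \<theta> v r "\<theta> - \<phi>" m] assms va vb
    by (simp_all add: m\<theta> s flip: \<theta>_def)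
  have ab: "?u a = ?w a" "?u b = ?w b"
    using u w by (cases "even m"; simp)+
  define p where "p = 2 * cos \<theta>"
  \<comment> \<open>The corrections \<open>c\<close> and \<open>d\<close> solve the two linear equations of \<open>cd\<close>, which express invariance
     under \<open>a\<close> and \<open>b\<close>; their determinant is \<open>4 - p\<^sup>2 = 4 (sin \<theta>)\<^sup>2\<close>.\<close>
  define c where "c = (2 * K a y + p * K b y) / (4 - p\<^sup>2)"
  define d where "d = (2 * K b y + p * K a y) / (4 - p\<^sup>2)"
  have "4 - p\<^sup>2 = 4 * (sin \<theta>)\<^sup>2"
    by (simp add: p_def power_mult_distrib cos_squared_eq)
  then have p: "4 - p\<^sup>2 \<noteq> 0" using sin by simp
  have cd: "K a y + p * d = 2 * c" "K b y + p * c = 2 * d"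
    using p by (simp_all add: c_def d_def field_simps power2_eq_square)
  define I where "I v = v y + c * v a + d * v b" for v :: "'a \<Rightarrow> real"
  have "I (fire K a v) = I v + (K a y + p * d - 2 * c) * v a" for v
    using assms by (simp add: I_def fire_def p_def \<theta>_def algebra_simps)
  moreover have "I (fire K b v) = I v + (K b y + p * c - 2 * d) * v b" for v
    using assms by (simp add: I_def fire_def p_def \<theta>_def algebra_simps)
  ultimately have "I ?u = I v" "I ?w = I v"
    using cd by (auto intro!: act_alternating_invariant)
  then show "?u y = ?w y" using ab by (simp add: I_def)
qed

lemma act_coxeter_eq:
  assumes "defining_graph \<Gamma>"
    and "pres_eq (verts \<Gamma>) (artin_relations \<Gamma> \<union> {([(a, True), (a, True)], []) | a. a \<in> verts \<Gamma>}) u v"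
  shows "act (weight \<Gamma>) u = act (weight \<Gamma>) v"
  using assms(2)
proof (induction rule: pres_eq.induct)
  case (cong u v p q)
  then show ?case by (intro ext) simp
next
  case (cancel x b)
  then show ?case by (intro ext) (simp add: fire_fire weight_def)
next
  case (relation u v)
  then consider a where "u = [(a, True), (a, True)]" "v = []"
    | a b m where "coef \<Gamma> {a, b} = Some m" "u = alternating m a b" "v = alternating m b a"
    unfolding artin_relations_def by blast
  then show ?case
  proof cases
    case 1
    then show ?thesis by (intro ext) (simp add: fire_fire weight_def)
  next
    case 2
    have "{a, b} \<in> dom (coef \<Gamma>)" "m \<in> ran (coef \<Gamma>)" using 2(1) by (auto simp: ran_def)
    then have "card {a, b} = 2" "m \<ge> 2"
      using assms(1) unfolding defining_graph_def by blast+
    then show ?thesis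
      unfolding 2(2,3) using 2(1)
      by (intro braid_relation) (auto simp: weight_def insert_commute)
  qed
qed simp_all

text \<open>Labels \<open>m \<ge> 6\<close> and \<open>\<infinity>\<close> are the ones for which \<open>2 cos (\<pi> / m) \<ge> \<surd>3\<close>. Any larger bound would
  do for the asymptotics as well; this one leaves room in the estimate of
  \<open>not_spherical_if_two_large\<close> even when the third label is 2.\<close>

definition large :: "nat option \<Rightarrow> bool" where
  "large l \<longleftrightarrow> (\<forall>m. l = Some m \<longrightarrow> m \<ge> 6)"

lemma weight_large:
  assumes "a \<noteq> b" "large (coef \<Gamma> {a, b})"
  shows "weight \<Gamma> a b \<ge> 17 / 10"
proof (cases "coef \<Gamma> {a, b}")
  case (Some m)
  then have m: "m \<ge> 6" using assms by (simp add: large_def)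
  have "17 / 10 \<le> sqrt 3" by (rule real_le_rsqrt) (simp add: power2_eq_square)
  also have "\<dots> = 2 * cos (pi / 6)" by (simp add: cos_30)
  also have "cos (pi / 6) \<le> cos (pi / m)"
    using m by (intro cos_monotone_0_pi_le) (auto simp: field_simps)
  finally show ?thesis using assms Some by (simp add: weight_def)
qed (use assms in \<open>simp add: weight_def\<close>)

lemma weight_nonneg:
  assumes "defining_graph \<Gamma>" "a \<noteq> b"
  shows "weight \<Gamma> a b \<ge> 0"
proof (cases "coef \<Gamma> {a, b}")
  case (Some m)
  then have "m \<in> ran (coef \<Gamma>)" by (auto simp: ran_def)
  then have "m \<ge> 2" using assms(1) by (auto simp: defining_graph_def)
  then have "0 \<le> cos (pi / m)" by (intro cos_ge_zero) (auto simp: field_simps intro: order.trans[of _ 0])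
  then show ?thesis using assms Some by (simp add: weight_def)
qed (use assms in \<open>simp add: weight_def\<close>)

text \<open>The values at \<open>a\<close> along the powers of the Coxeter element \<open>a b c\<close> are strictly increasing, so
  these powers are pairwise distinct. If the value at \<open>a\<close> is \<open>X > 0\<close>, it is passed on to \<open>b\<close> and \<open>c\<close> with
  weight at least \<open>17/10\<close>. Even if these start at \<open>-7/10 X\<close>, they reach at least \<open>X\<close>, and they
  hand back so much to \<open>a\<close> that the new value exceeds \<open>X\<close> and again dominates the debts of \<open>b\<close> and
  \<open>c\<close>.\<close>

lemma not_spherical_if_two_large:
  assumes \<Gamma>: "defining_graph \<Gamma>" "{a, b, c} \<subseteq> verts \<Gamma>"
    and ne: "a \<noteq> b" "a \<noteq> c" "b \<noteq> c"
    and large: "large (coef \<Gamma> {a, b})" "large (coef \<Gamma> {a, c})"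
  shows "\<not> spherical \<Gamma>"
proof
  assume "spherical \<Gamma>"
  let ?R = "artin_relations \<Gamma> \<union> {([(a, True), (a, True)], []) | a. a \<in> verts \<Gamma>}"
  let ?K = "weight \<Gamma>"
  define abc where "abc = [(a, True), (b, True), (c, True)]"
  define w where "w n = ((\<lambda>u. u @ abc) ^^ n) []" for n
  define v where "v n = act ?K (w n) (\<lambda>y. of_bool (y = a))" for n
  have v_Suc: "v (Suc n) = act ?K abc (v n)" for n
    by (simp add: v_def w_def)
  have K: "?K a b \<ge> 17/10" "?K a c \<ge> 17/10" "?K b c \<ge> 0"
    using weight_large[OF ne(1) large(1)] weight_large[OF ne(2) large(2)]
      weight_nonneg[OF \<Gamma>(1) ne(3)] by simp_all
  have sym: "?K x y = ?K y x" "?K x x = -2" for x y by (simp_all add: weight_def insert_commute)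
  have grow: "v n a > 0 \<and> v n b \<ge> - 7/10 * v n a \<and> v n c \<ge> - 7/10 * v n a \<and> v (Suc n) a > v n a" for n
  proof -
    have step: "v (Suc n) a > v n a \<and> v (Suc n) b \<ge> - 7/10 * v (Suc n) a \<and> v (Suc n) c \<ge> - 7/10 * v (Suc n) a"
      if IH: "v n a > 0" "v n b \<ge> - 7/10 * v n a" "v n c \<ge> - 7/10 * v n a" for n
    proof -
      \<comment> \<open>\<open>y\<close> and \<open>z\<close> are the values at \<open>b\<close> and \<open>c\<close> at the moment when they are fired.\<close>
      define y where "y = v n b + ?K a b * v n a"
      define z where "z = v n c + ?K a c * v n a + ?K b c * y"
      have new: "v (Suc n) a = - v n a + ?K a b * y + ?K a c * z"
        "v (Suc n) b = - y + ?K b c * z" "v (Suc n) c = - z"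
        using ne by (simp_all add: v_Suc abc_def fire_def y_def z_def sym algebra_simps)
      have "?K a b * v n a \<ge> 17/10 * v n a" "?K a c * v n a \<ge> 17/10 * v n a"
        using K IH(1) by (intro mult_right_mono; linarith)+
      then have y: "y \<ge> v n a" and z': "v n c + ?K a c * v n a \<ge> v n a" using IH unfolding y_def by linarith+
      have "?K b c * y \<ge> 0" using K y IH by (intro mult_nonneg_nonneg; linarith)
      then have z: "z \<ge> v n a" using z' unfolding z_def by linarith
      have "?K a b * y \<ge> 17/10 * y" "?K a c * z \<ge> 17/10 * z" "?K b c * z \<ge> 0"
        using K y z IH(1) by (intro mult_right_mono mult_nonneg_nonneg; linarith)+
      moreover have "- 7/10 * (- X + P + Q) \<le> - Y + R \<and> - 7/10 * (- X + P + Q) \<le> - Z \<and> - X + P + Q > X"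
        if "P \<ge> 17/10 * Y" "Q \<ge> 17/10 * Z" "R \<ge> 0" "Y \<ge> X" "Z \<ge> X" "X > 0" for X Y Z P Q R :: real
        using that by (auto simp: field_simps)
      ultimately show ?thesis unfolding new using y z IH(1) by blast
    qed
    have inv: "v n a > 0 \<and> v n b \<ge> - 7/10 * v n a \<and> v n c \<ge> - 7/10 * v n a"
    proof (induction n)
      case 0
      show ?case using ne by (simp add: v_def w_def)
    next
      case (Suc n)
      then show ?case using step[of n] by auto
    qed
    then show ?thesis using step by blast
  qed
  have "strict_mono (\<lambda>n. v n a)" using grow by (simp add: strict_mono_Suc_iff)
  have gw: "w n \<in> gwords (verts \<Gamma>)" for n
    using \<Gamma> by (induction n) (auto simp: w_def abc_def)
  have "inj (\<lambda>n. pres_rel (verts \<Gamma>) ?R `` {w n})"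
  proof (rule injI)
    fix n m assume "pres_rel (verts \<Gamma>) ?R `` {w n} = pres_rel (verts \<Gamma>) ?R `` {w m}"
    then have "(w n, w m) \<in> pres_rel (verts \<Gamma>) ?R"
      by (rule eq_equiv_class[OF _ equiv_pres_rel gw])
    then have "v n = v m"
      unfolding v_def using act_coxeter_eq[OF \<Gamma>(1)] by (simp add: pres_rel_def)
    then show "n = m" using \<open>strict_mono _\<close> by (metis strict_mono_eq)
  qed
  moreover have "range (\<lambda>n. pres_rel (verts \<Gamma>) ?R `` {w n}) \<subseteq> carrier (coxeter_group \<Gamma>)"
    using gw by (auto simp: coxeter_group_def presented_group_def intro: quotientI)
  moreover have "finite (carrier (coxeter_group \<Gamma>))"
    using \<open>spherical \<Gamma>\<close> by (simp add: spherical_def)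
  ultimately have "finite (UNIV :: nat set)"
    using finite_subset finite_imageD by meson
  then show False by simp
qed

section \<open>Finite Coxeter groups of triangles\<close>

text \<open>Since \<open>c\<close> commutes with \<open>a\<close> and \<open>b\<close>, it can be moved to the front of any word; what remains is a
  word in \<open>a\<close> and \<open>b\<close>, which the squares make alternating and the braid relation makes of length at
  most \<open>m\<close>. Multiplying such a normal form by a letter leads to a normal form again, so the
  finitely many normal forms exhaust the group.\<close>

lemma spherical_2_2_m:
  assumes verts: "verts \<Gamma> = {a, b, c}"
    and c: "coef \<Gamma> {c, a} = Some 2" "coef \<Gamma> {c, b} = Some 2"
    and m: "coef \<Gamma> {a, b} = Some m" "m > 0"
  shows "spherical \<Gamma>"
proof -
  let ?S = "verts \<Gamma>"
  let ?R = "artin_relations \<Gamma> \<union> {([(a, True), (a, True)], []) | a. a \<in> verts \<Gamma>}"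
  let ?eq = "pres_eq ?S ?R"
  define NF where "NF = (\<Union>k\<in>{..m}. \<Union>(p, q)\<in>{(a, b), (b, a)}.
    {alternating k p q, (c, True) # alternating k p q})"
  have alt: "alternating k x y \<in> gwords ?S" if "(x, y) \<in> {(a, b), (b, a)}" for k x y
    using that by (induction k arbitrary: x y) (auto simp: verts)
  note [trans] = pres_eq.trans
  have square: "?eq [(x, True), (x, True)] []" if "x \<in> ?S" for x
    using that by (intro pres_eq.relation) auto
  have commute: "?eq [(x, True), (c, True)] [(c, True), (x, True)]" if "x \<in> {a, b}" for x
  proof -
    have "coef \<Gamma> {x, c} = Some 2" using that c by (auto simp: insert_commute)
    then have "(alternating 2 x c, alternating 2 c x) \<in> ?R" unfolding artin_relations_def by blast
    then have "?eq (alternating 2 x c) (alternating 2 c x)"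
      using that by (intro pres_eq.relation) (auto simp: verts numeral_2_eq_2)
    then show ?thesis by (simp add: numeral_2_eq_2)
  qed
  have braid: "?eq (alternating m a b) (alternating m b a)"
    using m by (intro pres_eq.relation alt) (auto simp: artin_relations_def)
  have NF_a: "alternating k x y \<in> NF" and NF_c: "(c, True) # alternating k x y \<in> NF"
    if "k \<le> m" "(x, y) \<in> {(a, b), (b, a)}" for k x y
  proof -
    have "{alternating k x y, (c, True) # alternating k x y} \<subseteq> NF"
      unfolding NF_def
      by (rule order_trans[OF _ UN_upper[of k]], rule order_trans[OF _ UN_upper[of "(x, y)"]])
        (use that in auto)
    then show "alternating k x y \<in> NF" "(c, True) # alternating k x y \<in> NF" by simp_all
  qed
  have letter: "\<exists>w'. w' \<in> NF \<and> (c, True) # w' \<in> NF \<and> ?eq ((x, True) # alternating k p q) w'"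
    if "x \<in> {a, b}" "k \<le> m" "(p, q) \<in> {(a, b), (b, a)}" for x k p q
  proof -
    have qp: "(q, p) \<in> {(a, b), (b, a)}" and x: "x = p \<or> x = q" using that by auto
    have gw: "alternating j p q \<in> gwords ?S" "alternating j q p \<in> gwords ?S" for j
      by (rule alt[OF that(3)], rule alt[OF qp])
    have pS: "p \<in> ?S" "q \<in> ?S" using that(3) verts by auto
    have drop_square: "?eq ((y, True) # (y, True) # w) w" if "w \<in> gwords ?S" "y \<in> ?S" for y w
      using pres_eq_append[OF square[OF that(2)] pres_eq.refl[OF that(1)]] by simp
    have cancel: "?eq ((p, True) # alternating (Suc j) p q) (alternating j q p)"
      if "alternating j q p \<in> gwords ?S" "p \<in> ?S" for j p q
      using drop_square[OF that] by simp
    have braid': "?eq (alternating m p q) (alternating m q p)"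
      using braid that(3) pres_eq.sym[OF braid] by auto
    \<comment> \<open>A letter either cancels the first one of the alternating word or extends the word. Extending a
       word of length \<open>m\<close> is avoided by turning it round first, which makes the letter cancel.\<close>
    consider j where "x = p" "k = Suc j" | "x = p" "k = 0" | "x = q" "k < m" | "x = q" "k = m"
      using x le_imp_less_or_eq[OF \<open>k \<le> m\<close>] not0_implies_Suc[of k] by blast
    then show ?thesis
    proof cases
      case 1
      then have "?eq ((x, True) # alternating k p q) (alternating j q p)"
        using cancel[OF gw(2)[of j] pS(1)] by (simp only:)
      moreover have "j \<le> m" using 1 that(2) by simp
      ultimately show ?thesis using NF_a[OF _ qp] NF_c[OF _ qp] by blast
    next
      case 2
      then have "(x, True) # alternating k p q = alternating (Suc 0) p q" by simp
      then have "?eq ((x, True) # alternating k p q) (alternating (Suc 0) p q)"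
        by (simp only: pres_eq.refl[OF gw(1)])
      moreover have "Suc 0 \<le> m" using m(2) by simp
      ultimately show ?thesis using NF_a[OF _ that(3)] NF_c[OF _ that(3)] by blast
    next
      case 3
      then have "(x, True) # alternating k p q = alternating (Suc k) q p" by simp
      then have "?eq ((x, True) # alternating k p q) (alternating (Suc k) q p)"
        by (simp only: pres_eq.refl[OF gw(2)])
      moreover have "Suc k \<le> m" using 3 by simp
      ultimately show ?thesis using NF_a[OF _ qp] NF_c[OF _ qp] by blast
    next
      case 4
      obtain j where j: "m = Suc j" using m(2) not0_implies_Suc by blast
      have "[(q, True)] \<in> gwords ?S" using pS by simp
      then have "?eq ([(q, True)] @ alternating m p q) ([(q, True)] @ alternating m q p)"
        by (intro pres_eq_append braid' pres_eq.refl)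
      then have "?eq ((q, True) # alternating m p q) ((q, True) # alternating m q p)"
        by (simp only: append_Cons append_Nil)
      also have "?eq ((q, True) # alternating m q p) (alternating j p q)"
        unfolding j by (rule cancel[OF gw(1) pS(2)])
      finally have "?eq ((x, True) # alternating k p q) (alternating j p q)" using 4 by (simp only:)
      moreover have "j \<le> m" using j by simp
      ultimately show ?thesis using NF_a[OF _ that(3)] NF_c[OF _ that(3)] by blast
    qed
  qed
  have step: "\<exists>w'\<in>NF. ?eq ((x, True) # w) w'" if "w \<in> NF" "x \<in> ?S" for w x
  proof -
    obtain k p q where kpq: "k \<le> m" "(p, q) \<in> {(a, b), (b, a)}"
      and w: "w = alternating k p q \<or> w = (c, True) # alternating k p q"
      using \<open>w \<in> NF\<close> unfolding NF_def by fast
    have gw: "alternating k p q \<in> gwords ?S" by (rule alt[OF kpq(2)])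
    show ?thesis
    proof (cases "x = c")
      case True
      from w show ?thesis
      proof
        assume "w = alternating k p q"
        moreover have "(c, True) # alternating k p q \<in> gwords ?S"
          using gw True that(2) by (simp only: Cons_in_lists_iff mem_Sigma_iff UNIV_I simp_thms)
        ultimately show ?thesis using NF_c[OF kpq] True by (blast intro: pres_eq.refl)
      next
        assume "w = (c, True) # alternating k p q"
        then have "?eq ((x, True) # w) (alternating k p q)"
          using True pres_eq_append[OF square[OF that(2)] pres_eq.refl[OF gw]] by simp
        then show ?thesis using NF_a[OF kpq] by blast
      qed
    next
      case False
      then have x: "x \<in> {a, b}" using that(2) verts by auto
      obtain w' where w': "w' \<in> NF" "(c, True) # w' \<in> NF" "?eq ((x, True) # alternating k p q) w'"
        using letter[OF x kpq] by blast
      from w show ?thesis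
      proof
        assume "w = alternating k p q"
        then show ?thesis using w' by blast
      next
        assume "w = (c, True) # alternating k p q"
        then have "?eq ((x, True) # w) ((c, True) # (x, True) # alternating k p q)"
          using pres_eq_append[OF commute[OF x] pres_eq.refl[OF gw]] by simp
        also have "?eq \<dots> ((c, True) # w')"
        proof -
          have "[(c, True)] \<in> gwords ?S" by (simp add: verts)
          from pres_eq_append[OF pres_eq.refl[OF this] w'(3)] show ?thesis
            by (simp only: append_Cons append_Nil)
        qed
        finally show ?thesis using w'(2) by blast
      qed
    qed
  qed
  have normal: "\<exists>w'\<in>NF. ?eq w w'" if "w \<in> gwords ?S" for w
    using that
  proof (induction w rule: list.induct)
    case Nil
    have "[] \<in> NF" using NF_a[of 0 a b] by simp
    then show ?case by (auto intro: pres_eq.refl)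
  next
    case (Cons l w)
    obtain x s where l: "l = (x, s)" by force
    have x: "x \<in> ?S" and w: "w \<in> gwords ?S"
      using Cons.prems l by (simp_all only: Cons_in_lists_iff mem_Sigma_iff)
    have gx: "[(x, b)] \<in> gwords ?S" for b using x by simp
    obtain w1 where w1: "w1 \<in> NF" "?eq w w1" using Cons.IH[OF w] by blast
    have "?eq [l] [(x, True)]"
    proof (cases s)
      case True
      then show ?thesis unfolding l using pres_eq.refl[OF gx] by (simp only:)
    next
      case False
      have "?eq [(x, False)] [(x, False), (x, True), (x, True)]"
        using pres_eq_append[OF pres_eq.refl[OF gx] pres_eq.sym[OF square[OF x]]]
        by (simp only: append_Cons append_Nil append_Nil2)
      also have "?eq [(x, False), (x, True), (x, True)] [(x, True)]"
        using pres_eq_append[OF pres_eq.cancel[OF x, of _ False] pres_eq.refl[OF gx]]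
        by (simp only: append_Cons append_Nil not_False_eq_True)
      finally show ?thesis using False by (simp only: l)
    qed
    then have "?eq (l # w) ((x, True) # w1)"
      using pres_eq_append[OF _ w1(2), of "[l]" "[(x, True)]"] by (simp only: append_Cons append_Nil)
    moreover obtain w2 where "w2 \<in> NF" "?eq ((x, True) # w1) w2" using step[OF w1(1) x] by blast
    ultimately show ?case by (blast intro: pres_eq.trans)
  qed
  have "carrier (coxeter_group \<Gamma>) \<subseteq> (\<lambda>w. pres_rel ?S ?R `` {w}) ` NF"
  proof
    fix X assume "X \<in> carrier (coxeter_group \<Gamma>)"
    then have "X \<in> gwords ?S // pres_rel ?S ?R"
      by (simp only: coxeter_group_def presented_group_def partial_object.simps)
    then obtain w where w: "w \<in> gwords ?S" "X = pres_rel ?S ?R `` {w}"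
      by (rule quotientE)
    obtain w' where "w' \<in> NF" "?eq w w'" using normal[OF w(1)] by blast
    then have "X = pres_rel ?S ?R `` {w'}"
      unfolding w(2) by (intro equiv_class_eq[OF equiv_pres_rel]) (simp add: pres_rel_def)
    then show "X \<in> (\<lambda>w. pres_rel ?S ?R `` {w}) ` NF" using \<open>w' \<in> NF\<close> by blast
  qed
  moreover have "finite NF" by (simp add: NF_def)
  ultimately show ?thesis unfolding spherical_def by (meson finite_imageI finite_subset)
qed

section \<open>Proportions in a finite set and the second moment method\<close>

definition proportion :: "'g set \<Rightarrow> ('g \<Rightarrow> bool) \<Rightarrow> real" where
  "proportion G P = real (card {g \<in> G. P g}) / real (card G)"

lemma proportion_eq_sum:
  "finite G \<Longrightarrow> proportion G P = (\<Sum>g\<in>G. of_bool (P g)) / real (card G)"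
  by (simp add: proportion_def Int_def)

lemma proportion_mono:
  assumes "finite G" "\<And>g. g \<in> G \<Longrightarrow> P g \<Longrightarrow> Q g"
  shows "proportion G P \<le> proportion G Q"
proof -
  have "card {g \<in> G. P g} \<le> card {g \<in> G. Q g}"
    using assms by (intro card_mono) auto
  then show ?thesis unfolding proportion_def by (intro divide_right_mono) simp_all
qed

lemma proportion_nonneg: "proportion G P \<ge> 0"
  by (simp add: proportion_def)

lemma proportion_not:
  assumes "finite G" "G \<noteq> {}"
  shows "proportion G (\<lambda>g. \<not> P g) = 1 - proportion G P"
proof -
  have "card G = card {g \<in> G. P g} + card {g \<in> G. \<not> P g}"
    using assms(1) by (subst card_Un_disjoint[symmetric]) (auto intro: arg_cong[where f = card])
  then have "real (card G) = real (card {g \<in> G. P g}) + real (card {g \<in> G. \<not> P g})" by simp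
  then have "(real (card {g \<in> G. P g}) + real (card {g \<in> G. \<not> P g})) / real (card G) = 1"
    using assms by (metis add_divide_distrib card_gt_0_iff divide_self_if of_nat_0_less_iff order_less_irrefl)
  then show ?thesis unfolding proportion_def add_divide_distrib by linarith
qed

lemma proportion_Ex_le:
  assumes "finite G" "finite T"
  shows "proportion G (\<lambda>g. \<exists>t\<in>T. E t g) \<le> (\<Sum>t\<in>T. proportion G (E t))"
proof -
  have "{g \<in> G. \<exists>t\<in>T. E t g} = (\<Union>t\<in>T. {g \<in> G. E t g})" by auto
  then have "card {g \<in> G. \<exists>t\<in>T. E t g} \<le> (\<Sum>t\<in>T. card {g \<in> G. E t g})"
    using card_UN_le[OF assms(2)] by metis
  then have "real (card {g \<in> G. \<exists>t\<in>T. E t g}) \<le> (\<Sum>t\<in>T. real (card {g \<in> G. E t g}))"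
    by (simp flip: of_nat_sum)
  then show ?thesis
    unfolding proportion_def sum_divide_distrib[symmetric] by (rule divide_right_mono) simp
qed

text \<open>Chebyshev's inequality for the number \<open>X\<close> of events that occur: where none occurs, \<open>X\<close> deviates
  from its mean \<open>\<mu>\<close> by \<open>\<mu>\<close>, and the variance is the sum of the probabilities of all pairs minus
  \<open>\<mu>\<^sup>2\<close>.\<close>

lemma second_moment:
  fixes E :: "'t \<Rightarrow> 'g \<Rightarrow> bool"
  assumes "finite G" "finite T"
  defines "\<mu> \<equiv> \<Sum>t\<in>T. proportion G (E t)"
  shows "proportion G (\<lambda>g. \<forall>t\<in>T. \<not> E t g) * \<mu>\<^sup>2
      \<le> (\<Sum>t\<in>T. \<Sum>s\<in>T. proportion G (\<lambda>g. E t g \<and> E s g)) - \<mu>\<^sup>2"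
proof (cases "G = {}")
  case True
  then show ?thesis by (simp add: \<mu>_def proportion_def)
next
  case False
  define X where "X g = (\<Sum>t\<in>T. of_bool (E t g) :: real)" for g
  have pos: "real (card G) > 0" using False assms by (simp add: card_gt_0_iff)
  have \<mu>: "(\<Sum>g\<in>G. X g) = card G * \<mu>"
    unfolding \<mu>_def X_def using pos
    False
    by (subst sum.swap) (simp add: proportion_eq_sum assms sum_distrib_left)
  have "card G * (\<Sum>t\<in>T. \<Sum>s\<in>T. proportion G (\<lambda>g. E t g \<and> E s g))
      = (\<Sum>t\<in>T. \<Sum>s\<in>T. \<Sum>g\<in>G. of_bool (E t g) * of_bool (E s g))"
    using pos unfolding sum_distrib_left
    by (intro sum.cong[OF HOL.refl]) (simp add: proportion_eq_sum assms(1) of_bool_conj)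
  also have "\<dots> = (\<Sum>t\<in>T. \<Sum>g\<in>G. \<Sum>s\<in>T. of_bool (E t g) * of_bool (E s g))"
    by (intro sum.cong[OF HOL.refl] sum.swap)
  also have "\<dots> = (\<Sum>g\<in>G. \<Sum>t\<in>T. \<Sum>s\<in>T. of_bool (E t g) * of_bool (E s g))"
    by (rule sum.swap)
  also have "\<dots> = (\<Sum>g\<in>G. (X g)\<^sup>2)"
    unfolding X_def power2_eq_square sum_product ..
  finally have X2: "(\<Sum>g\<in>G. (X g)\<^sup>2) = card G * (\<Sum>t\<in>T. \<Sum>s\<in>T. proportion G (\<lambda>g. E t g \<and> E s g))" ..
  have "card G * (proportion G (\<lambda>g. \<forall>t\<in>T. \<not> E t g) * \<mu>\<^sup>2)
      = (\<Sum>g\<in>G. of_bool (\<forall>t\<in>T. \<not> E t g) * \<mu>\<^sup>2)"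
    using pos by (simp add: proportion_eq_sum assms(1) flip: sum_distrib_right)
  also have "\<dots> \<le> (\<Sum>g\<in>G. (X g - \<mu>)\<^sup>2)"
    by (intro sum_mono) (auto simp: X_def)
  also have "\<dots> = (\<Sum>g\<in>G. (X g)\<^sup>2) - 2 * \<mu> * (\<Sum>g\<in>G. X g) + card G * \<mu>\<^sup>2"
  proof -
    have "(X g - \<mu>)\<^sup>2 = (X g)\<^sup>2 - 2 * \<mu> * X g + \<mu>\<^sup>2" for g
      by (simp add: power2_diff)
    then show ?thesis by (simp add: sum.distrib sum_subtractf flip: sum_distrib_left)
  qed
  also have "\<dots> = card G * ((\<Sum>t\<in>T. \<Sum>s\<in>T. proportion G (\<lambda>g. E t g \<and> E s g)) - \<mu>\<^sup>2)"
    by (simp add: \<mu> X2 right_diff_distrib) (simp add: power2_eq_square)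
  finally show ?thesis using pos by simp
qed

section \<open>Labels of distinct edges are independent\<close>

definition edges :: "nat \<Rightarrow> nat set set" where
  "edges N = {e. e \<subseteq> {..<N} \<and> card e = 2}"

definition labels :: "nat \<Rightarrow> nat option set" where
  "labels M = insert None (Some ` {2..M})"

lemma finite_edges: "finite (edges N)"
proof -
  have "edges N \<subseteq> Pow {..<N}"
    by (auto simp: edges_def)
  then show ?thesis
    by (rule finite_subset) simp
qed

lemma card_labels: "M \<ge> 1 \<Longrightarrow> card (labels M) = M"
proof -
  assume M: "M \<ge> 1"
  have "card (Some ` {2..M}) = M - 1"
    by (simp add: card_image)
  moreover have "None \<notin> Some ` {2..M}"
    by auto
  ultimately show ?thesis
    using M by (simp add: labels_def)
qed

lemma card_graphs_labels_in:
  assumes "\<And>e. e \<in> edges N \<Longrightarrow> S e \<subseteq> labels M"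
  shows "card {\<Gamma> \<in> graphs N M. \<forall>e\<in>edges N. coef \<Gamma> e \<in> S e} = (\<Prod>e\<in>edges N. card (S e))"
proof -
  let ?A = "{\<Gamma> \<in> graphs N M. \<forall>e\<in>edges N. coef \<Gamma> e \<in> S e}" and ?B = "PiE (edges N) S"
  have "bij_betw (\<lambda>\<Gamma>. restrict (coef \<Gamma>) (edges N)) ?A ?B"
  proof (rule bij_betw_byWitness[where
        f' = "\<lambda>g. \<lparr>verts = {..<N}, coef = (\<lambda>e. if e \<in> edges N then g e else None)\<rparr>"])
    show "\<forall>\<Gamma>\<in>?A. \<lparr>verts = {..<N},
        coef = (\<lambda>e. if e \<in> edges N then restrict (coef \<Gamma>) (edges N) e else None)\<rparr> = \<Gamma>"
    proof
      fix \<Gamma> assume "\<Gamma> \<in> ?A"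
      then have "dom (coef \<Gamma>) \<subseteq> edges N" "verts \<Gamma> = {..<N}"
        by (auto simp: graphs_def defining_graph_def edges_def)
      moreover from this have "coef \<Gamma> e = None" if "e \<notin> edges N" for e
        using that by (meson domIff subsetD)
      then have "(\<lambda>e. if e \<in> edges N then restrict (coef \<Gamma>) (edges N) e else None) = coef \<Gamma>"
        by (simp add: fun_eq_iff)
      ultimately show "\<lparr>verts = {..<N},
        coef = (\<lambda>e. if e \<in> edges N then restrict (coef \<Gamma>) (edges N) e else None)\<rparr> = \<Gamma>"
        by simp
    qed
    show "\<forall>g\<in>?B. restrict (coef \<lparr>verts = {..<N}, coef = (\<lambda>e. if e \<in> edges N then g e else None)\<rparr>) (edges N) = g"
      by (auto simp: fun_eq_iff PiE_def extensional_def)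
    show "(\<lambda>\<Gamma>. restrict (coef \<Gamma>) (edges N)) ` ?A \<subseteq> ?B" by auto
    show "(\<lambda>g. \<lparr>verts = {..<N}, coef = (\<lambda>e. if e \<in> edges N then g e else None)\<rparr>) ` ?B \<subseteq> ?A"
    proof (intro image_subsetI CollectI conjI)
      fix g assume g: "g \<in> ?B"
      let ?\<Gamma> = "\<lparr>verts = {..<N}, coef = (\<lambda>e. if e \<in> edges N then g e else None)\<rparr>"
      show "\<forall>e\<in>edges N. coef ?\<Gamma> e \<in> S e" using g by (auto dest: PiE_mem)
      have "l \<in> {2..M}" if "e \<in> edges N" "g e = Some l" for e l
        using PiE_mem[OF g that(1)] assms[OF that(1)] that(2) by (auto simp: labels_def)
      then have "ran (coef ?\<Gamma>) \<subseteq> {2..M}"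
        by (auto simp: ran_def split: if_splits)
      then show "?\<Gamma> \<in> graphs N M"
        by (auto simp: graphs_def defining_graph_def edges_def split: if_splits)
    qed
  qed
  then have "card ?A = card ?B" by (rule bij_betw_same_card)
  then show ?thesis unfolding card_PiE[OF finite_edges] .
qed

lemma coef_in_labels: assumes "\<Gamma> \<in> graphs N M" shows "coef \<Gamma> e \<in> labels M"
proof (cases "coef \<Gamma> e")
  case None
  then show ?thesis
    by (simp add: labels_def)
next
  case (Some m)
  then have "m \<in> ran (coef \<Gamma>)"
    by (rule ranI)
  moreover have "ran (coef \<Gamma>) \<subseteq> {2..M}"
    using assms by (simp add: graphs_def)
  ultimately show ?thesis using Some
    by (auto simp: labels_def)
qed

text \<open>A random graph is a family of independent uniform labels, one for each potential edge; edges
  outside \<open>F\<close> are unconstrained and contribute the factor 1.\<close>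

lemma proportion_labels_in:
  assumes "M \<ge> 1" "F \<subseteq> edges N" "\<And>e. e \<in> F \<Longrightarrow> S e \<subseteq> labels M"
  shows "proportion (graphs N M) (\<lambda>\<Gamma>. \<forall>e\<in>F. coef \<Gamma> e \<in> S e) = (\<Prod>e\<in>F. card (S e) / M)"
proof -
  let ?S = "\<lambda>e. if e \<in> F then S e else labels M"
  have "{\<Gamma> \<in> graphs N M. \<forall>e\<in>F. coef \<Gamma> e \<in> S e} = {\<Gamma> \<in> graphs N M. \<forall>e\<in>edges N. coef \<Gamma> e \<in> ?S e}"
    using assms(2) coef_in_labels by auto
  then have "card {\<Gamma> \<in> graphs N M. \<forall>e\<in>F. coef \<Gamma> e \<in> S e} = (\<Prod>e\<in>edges N. card (?S e))"
    using card_graphs_labels_in[of N ?S M] assms(3) by auto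
  moreover have "card (graphs N M) = (\<Prod>e\<in>edges N. M)"
    using card_graphs_labels_in[of N "\<lambda>_. labels M" M] assms(1)
    by (simp add: card_labels coef_in_labels cong: conj_cong)
  ultimately have "proportion (graphs N M) (\<lambda>\<Gamma>. \<forall>e\<in>F. coef \<Gamma> e \<in> S e)
      = (\<Prod>e\<in>edges N. card (?S e) / M)"
    unfolding proportion_def by (simp add: prod_dividef)
  also have "\<dots> = (\<Prod>e\<in>F. card (?S e) / M)"
    using assms by (intro prod.mono_neutral_right finite_edges) (auto simp: card_labels)
  also have "\<dots> = (\<Prod>e\<in>F. card (S e) / M)" by simp
  finally show ?thesis .
qed

lemma finite_graphs:
  assumes "M \<ge> 1"
  shows "finite (graphs N M)" "graphs N M \<noteq> {}"
proof -
  have "card (graphs N M) > 0" using card_graphs[OF assms] assms by simp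
  then show "finite (graphs N M)" "graphs N M \<noteq> {}" unfolding card_gt_0_iff by blast+
qed

section \<open>Graphs with many labels\<close>

lemma defining_graph_full_subgraph:
  assumes "defining_graph \<Gamma>" "W \<subseteq> verts \<Gamma>"
  shows "defining_graph (full_subgraph \<Gamma> W)"
proof -
  have "finite W" using assms finite_subset by (auto simp: defining_graph_def)
  moreover have "ran (coef \<Gamma> |` Pow W) \<subseteq> ran (coef \<Gamma>)"
    by (auto simp: ran_def restrict_map_def split: if_splits)
  ultimately show ?thesis
    using assms unfolding defining_graph_def full_subgraph_def by auto
qed

text \<open>In a spherical triangle no two labels are large, so two of the three are not, and any two edges
  of a triangle share a vertex.\<close>

lemma not_two_dimensional_small:
  assumes "defining_graph \<Gamma>" "\<not> two_dimensional \<Gamma>"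
  shows "\<exists>a b c. {a, b, c} \<subseteq> verts \<Gamma> \<and> a \<noteq> b \<and> a \<noteq> c \<and> b \<noteq> c \<and>
           \<not> large (coef \<Gamma> {a, b}) \<and> \<not> large (coef \<Gamma> {a, c})"
proof -
  obtain a b c where abc: "{a, b, c} \<subseteq> verts \<Gamma>" "a \<noteq> b" "a \<noteq> c" "b \<noteq> c"
    and "spherical (full_subgraph \<Gamma> {a, b, c})"
    using assms(2) unfolding two_dimensional_def by auto
  then have no: "\<not> (large (coef (full_subgraph \<Gamma> {a, b, c}) {x, y}) \<and> large (coef (full_subgraph \<Gamma> {a, b, c}) {x, z}))"
    if "{x, y, z} = {a, b, c}" "x \<noteq> y" "x \<noteq> z" "y \<noteq> z" for x y z
    using not_spherical_if_two_large[OF defining_graph_full_subgraph[OF assms(1) abc(1)], of x y z] that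
    by (auto simp: full_subgraph_def)
  have *: "\<not> (large (coef \<Gamma> {x, y}) \<and> large (coef \<Gamma> {x, z}))"
    if "{x, y, z} = {a, b, c}" "x \<noteq> y" "x \<noteq> z" "y \<noteq> z" for x y z
  proof -
    have "{x, y} \<subseteq> {a, b, c}" "{x, z} \<subseteq> {a, b, c}" using that(1) by auto
    then show ?thesis using no[OF that] by (simp add: full_subgraph_def)
  qed
  have "\<not> (large (coef \<Gamma> {a, b}) \<and> large (coef \<Gamma> {a, c}))"
    "\<not> (large (coef \<Gamma> {a, b}) \<and> large (coef \<Gamma> {b, c}))"
    "\<not> (large (coef \<Gamma> {a, c}) \<and> large (coef \<Gamma> {b, c}))"
    using *[of a b c] *[of b a c] *[of c a b] abc by (auto simp: insert_commute)
  then consider "\<not> large (coef \<Gamma> {a, b})" "\<not> large (coef \<Gamma> {a, c})"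
    | "\<not> large (coef \<Gamma> {b, a})" "\<not> large (coef \<Gamma> {b, c})"
    | "\<not> large (coef \<Gamma> {c, a})" "\<not> large (coef \<Gamma> {c, b})"
    by (auto simp: insert_commute)
  then show ?thesis
    by cases (use abc in blast)+
qed

text \<open>Union bound over the at most \<open>N\<^sup>3\<close> ordered triples: at each of the two edges only the labels
  \<open>2, 3, 4, 5\<close> out of \<open>M\<close> are admissible, which gives the factor \<open>(4 / M)\<^sup>2\<close>.\<close>

lemma proportion_not_two_dimensional_le:
  assumes "M \<ge> 1"
  shows "proportion (graphs N M) (\<lambda>\<Gamma>. \<not> two_dimensional \<Gamma>) \<le> 16 * real N ^ 3 / real M ^ 2"
proof -
  let ?G = "graphs N M"
  define S where "S = labels M \<inter> Some ` {2..5}"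
  have "card S \<le> card (Some ` {2..5::nat})" unfolding S_def by (intro card_mono) auto
  then have card_S: "card S \<le> 4" by (simp add: card_image)
  define T where "T = {(a, b, c). {a, b, c} \<subseteq> {..<N} \<and> a \<noteq> b \<and> a \<noteq> c \<and> b \<noteq> c}"
  have T: "T \<subseteq> {..<N} \<times> {..<N} \<times> {..<N}" by (auto simp: T_def)
  then have fT: "finite T" by (rule finite_subset) auto
  have cT: "card T \<le> N ^ 3" using card_mono[OF _ T] by (simp add: power3_eq_cube)
  define E :: "nat \<times> nat \<times> nat \<Rightarrow> nat dgraph \<Rightarrow> bool"
    where "E = (\<lambda>(a, b, c) \<Gamma>. \<forall>e\<in>{{a, b}, {a, c}}. coef \<Gamma> e \<in> S)"
  have "proportion ?G (\<lambda>\<Gamma>. \<not> two_dimensional \<Gamma>) \<le> proportion ?G (\<lambda>\<Gamma>. \<exists>t\<in>T. E t \<Gamma>)"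
  proof (rule proportion_mono)
    fix \<Gamma> assume \<Gamma>: "\<Gamma> \<in> ?G" "\<not> two_dimensional \<Gamma>"
    then obtain a b c where abc: "{a, b, c} \<subseteq> verts \<Gamma>" "a \<noteq> b" "a \<noteq> c" "b \<noteq> c"
      "\<not> large (coef \<Gamma> {a, b})" "\<not> large (coef \<Gamma> {a, c})"
      using not_two_dimensional_small by (metis (no_types, lifting) graphs_def mem_Collect_eq)
    have "coef \<Gamma> e \<in> S" if "\<not> large (coef \<Gamma> e)" for e
      using that coef_in_labels[OF \<Gamma>(1), of e] by (fastforce simp: S_def labels_def large_def)
    then have "E (a, b, c) \<Gamma>" "(a, b, c) \<in> T"
      using abc \<Gamma>(1) by (auto simp: E_def T_def graphs_def)
    then show "\<exists>t\<in>T. E t \<Gamma>" by blast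
  qed (use finite_graphs assms in blast)
  also have "\<dots> \<le> (\<Sum>t\<in>T. proportion ?G (E t))"
    by (rule proportion_Ex_le[OF finite_graphs(1)[OF assms] fT])
  also have "\<dots> \<le> (\<Sum>t\<in>T. 16 / real M ^ 2)"
  proof (rule sum_mono)
    fix t assume "t \<in> T"
    then obtain a b c where t: "t = (a, b, c)" "{a, b, c} \<subseteq> {..<N}" "a \<noteq> b" "a \<noteq> c" "b \<noteq> c"
      by (auto simp: T_def)
    have "proportion ?G (E t) = (\<Prod>e\<in>{{a, b}, {a, c}}. card S / M)"
      unfolding E_def t(1) prod.case using assms t
      by (intro proportion_labels_in) (auto simp: edges_def S_def)
    also have "\<dots> = (card S)\<^sup>2 / M\<^sup>2"
      using t by (simp add: doubleton_eq_iff power2_eq_square)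
    also have "\<dots> \<le> 4\<^sup>2 / M\<^sup>2"
      using card_S by (intro divide_right_mono) (simp_all add: power_mono del: power_numeral flip: of_nat_power)
    finally show "proportion ?G (E t) \<le> 16 / real M ^ 2" by simp
  qed
  also have "\<dots> = real (card T) * (16 / real M ^ 2)" by simp
  also have "\<dots> \<le> real (N ^ 3) * (16 / real M ^ 2)"
    using cT by (intro mult_right_mono of_nat_mono) auto
  finally show ?thesis by (simp add: mult.commute)
qed

section \<open>Graphs with few labels\<close>

text \<open>The vertices below \<open>3 n\<close> form three blocks of size \<open>n\<close>; the triple \<open>(i, j, k)\<close> stands for the
  triangle on the \<open>i\<close>-th, \<open>j\<close>-th and \<open>k\<close>-th vertex of the first, second and third block.\<close>

definition triangle :: "nat \<Rightarrow> nat \<times> nat \<times> nat \<Rightarrow> nat set set" where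
  "triangle n = (\<lambda>(i, j, k). {{i, n + j}, {i, 2 * n + k}, {n + j, 2 * n + k}})"

text \<open>Edges that meet the first block are required to have label 2, those between the second and the
  third block any finite label. So what is required of an edge does not depend on the triangle under
  consideration, and the joint event for two triangles is again of the form treated in
  \<open>proportion_labels_in\<close>.\<close>

definition spherical_labels :: "nat \<Rightarrow> nat \<Rightarrow> nat set \<Rightarrow> nat option set" where
  "spherical_labels n M e = (if \<exists>i<n. i \<in> e then {Some 2} else Some ` {2..M})"

lemma card_spherical_labels:
  assumes "i < n"
  shows "card (spherical_labels n M {i, x}) = 1"
    and "card (spherical_labels n M {n + j, 2 * n + k}) = M - 1"
  using assms by (auto simp: spherical_labels_def card_image)

lemma not_two_dimensional_if_triangle:
  assumes \<Gamma>: "\<Gamma> \<in> graphs N M" and "3 * n \<le> N" "i < n" "j < n" "k < n"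
    and lab: "\<forall>e\<in>triangle n (i, j, k). coef \<Gamma> e \<in> spherical_labels n M e"
  shows "\<not> two_dimensional \<Gamma>"
proof -
  let ?a = "n + j" and ?b = "2 * n + k"
  have "coef \<Gamma> {i, ?a} = Some 2" "coef \<Gamma> {i, ?b} = Some 2"
    using lab assms(3) by (auto simp: triangle_def spherical_labels_def split: if_splits)
  moreover obtain m where "coef \<Gamma> {?a, ?b} = Some m" "m \<ge> 2"
    using lab by (auto simp: triangle_def spherical_labels_def split: if_splits)
  ultimately have "spherical (full_subgraph \<Gamma> {?a, ?b, i})"
    by (intro spherical_2_2_m[of _ ?a ?b i m]) (auto simp: full_subgraph_def)
  moreover have "{?a, ?b, i} \<subseteq> verts \<Gamma>" "?a \<noteq> ?b" "?a \<noteq> i" "?b \<noteq> i"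
    using assms by (auto simp: graphs_def)
  ultimately show ?thesis unfolding two_dimensional_def by blast
qed

lemma prod_triangle:
  assumes "i < n" "j < n" "k < n"
  shows "prod h (triangle n (i, j, k)) = h {i, n + j} * h {i, 2 * n + k} * (h {n + j, 2 * n + k} :: real)"
  using assms by (auto simp: triangle_def doubleton_eq_iff mult.assoc)

lemma triangle_edges:
  assumes "3 * n \<le> N" "i < n" "j < n" "k < n"
  shows "triangle n (i, j, k) \<subseteq> edges N"
  using assms by (auto simp: triangle_def edges_def)

text \<open>Let \<open>p = 1 / M\<close> and \<open>q = 1 - 1 / M\<close> be the probabilities that an edge meeting, respectively
  avoiding, the first block has an admissible label, so that each triangle is spherical in the
  required way with probability \<open>P = p\<^sup>2 q\<close>. Two triangles without a common edge are independent; for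
  those with a common edge the probability of a shared edge is counted once instead of twice. For a
  fixed triangle there are \<open>n\<close> triangles through each of its edges. Hence the variance is at most
  \<open>\<mu> r\<close> with \<open>\<mu> = n\<^sup>3 P\<close> and \<open>r = 2 n p q + n p\<^sup>2 + 1\<close>, and by \<open>second_moment\<close> no such triangle exists
  with probability at most \<open>r / \<mu>\<close>.\<close>

lemma proportion_triangle_free_le:
  assumes n: "3 * n \<le> N" "n \<ge> 1" and M: "M \<ge> 2"
  shows "proportion (graphs N M) (\<lambda>\<Gamma>. two_dimensional \<Gamma>)
      \<le> 3 * (real M ^ 2 / real n ^ 3) + 1 / n + 2 / real n ^ 2"
proof -
  let ?G = "graphs N M"
  define T where "T = {..<n} \<times> {..<n} \<times> {..<n}"
  define E where "E t \<Gamma> \<longleftrightarrow> (\<forall>e\<in>triangle n t. coef \<Gamma> e \<in> spherical_labels n M e)"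
    for t and \<Gamma> :: "nat dgraph"
  define p where "p = 1 / real M"
  define q where "q = real (M - 1) / real M"
  define P where "P = p * p * q"
  have pq: "0 < p" "p \<le> 1" "1/2 \<le> q" "q \<le> 1" using M by (auto simp: p_def q_def field_simps of_nat_diff)
  then have P: "0 < P" by (simp add: P_def)
  have lab: "spherical_labels n M e \<subseteq> labels M" for e
    using M by (auto simp: spherical_labels_def labels_def)
  have fT: "finite T" by (simp add: T_def)
  have pE: "proportion ?G (E t) = P" if "t \<in> T" for t
  proof -
    obtain i j k where t: "t = (i, j, k)" "i < n" "j < n" "k < n" using \<open>t \<in> T\<close> by (auto simp: T_def)
    have "proportion ?G (E t) = (\<Prod>e\<in>triangle n t. card (spherical_labels n M e) / M)"
      unfolding E_def using M lab triangle_edges[OF n(1)] t by (intro proportion_labels_in) auto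
    then show ?thesis
      using t by (simp add: prod_triangle card_spherical_labels P_def p_def q_def)
  qed
  have pEE: "proportion ?G (\<lambda>\<Gamma>. E (i, j, k) \<Gamma> \<and> E (i', j', k') \<Gamma>)
      \<le> P * (P + of_bool (i = i' \<and> j = j') * (p * q) + of_bool (i = i' \<and> k = k') * (p * q)
           + of_bool (j = j' \<and> k = k') * (p * p) + of_bool (i = i' \<and> j = j' \<and> k = k'))"
    if ijk: "i < n" "j < n" "k < n" and ijk': "i' < n" "j' < n" "k' < n" for i j k i' j' k'
  proof -
    let ?t = "(i, j, k)" and ?s = "(i', j', k')"
    define w where "w e = card (spherical_labels n M e) / M" for e
    have "proportion ?G (\<lambda>\<Gamma>. E ?t \<Gamma> \<and> E ?s \<Gamma>)
        = proportion ?G (\<lambda>\<Gamma>. \<forall>e\<in>triangle n ?t \<union> triangle n ?s. coef \<Gamma> e \<in> spherical_labels n M e)"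
      by (simp add: E_def ball_Un)
    also have "\<dots> = prod w (triangle n ?t \<union> triangle n ?s)"
      unfolding w_def using M lab triangle_edges[OF n(1)] ijk ijk' by (intro proportion_labels_in) auto
    also have "\<dots> = prod w (triangle n ?s) * prod w (triangle n ?t - triangle n ?s)"
    proof -
      have "finite (triangle n ?t)" "finite (triangle n ?s)" by (simp_all add: triangle_def)
      then show ?thesis
        using prod.union_disjoint[of "triangle n ?s" "triangle n ?t - triangle n ?s" w]
        by (simp add: Un_commute)
    qed
    also have "prod w (triangle n ?t - triangle n ?s)
        = (\<Prod>e\<in>triangle n ?t. if e \<in> triangle n ?s then 1 else w e)"
    proof (rule prod.mono_neutral_cong_left)
      show "finite (triangle n ?t)" by (simp add: triangle_def)
    qed auto
    also have "\<dots> = (if i = i' \<and> j = j' then 1 else p) * (if i = i' \<and> k = k' then 1 else p)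
        * (if j = j' \<and> k = k' then 1 else q)"
      unfolding prod_triangle[OF ijk] using ijk ijk'
      by (intro arg_cong2[where f = "(*)"])
         (auto simp: triangle_def doubleton_eq_iff w_def card_spherical_labels p_def q_def)
    also have "prod w (triangle n ?s) = P"
      unfolding prod_triangle[OF ijk'] using ijk'
      by (simp add: w_def card_spherical_labels P_def p_def q_def)
    finally have eq: "proportion ?G (\<lambda>\<Gamma>. E ?t \<Gamma> \<and> E ?s \<Gamma>)
      = P * ((if i = i' \<and> j = j' then 1 else p) * (if i = i' \<and> k = k' then 1 else p)
        * (if j = j' \<and> k = k' then 1 else q))" .
    \<comment> \<open>The summands on the right cover the cases of no common edge, of one common edge of each of the
       three kinds, and of equal triangles; the case at hand always finds its own summand.\<close>
    have "p * q > 0" "p * p > 0" using pq by auto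
    then have "(if i = i' \<and> j = j' then 1 else p) * (if i = i' \<and> k = k' then 1 else p)
        * (if j = j' \<and> k = k' then 1 else q) \<le> (P + of_bool (i = i' \<and> j = j') * (p * q)
           + of_bool (i = i' \<and> k = k') * (p * q)
           + of_bool (j = j' \<and> k = k') * (p * p) + of_bool (i = i' \<and> j = j' \<and> k = k'))"
      using P by (cases "i = i'"; cases "j = j'"; cases "k = k'") (simp_all add: P_def)
    then show ?thesis unfolding eq using P by (intro mult_left_mono) auto
  qed
  define \<mu> where "\<mu> = real n ^ 3 * P"
  have \<mu>: "(\<Sum>t\<in>T. proportion ?G (E t)) = \<mu>"
    using pE by (simp add: T_def \<mu>_def power3_eq_cube)
  define r where "r = 2 * (n * (p * q)) + n * (p * p) + 1"
  have "(\<Sum>s\<in>T. proportion ?G (\<lambda>\<Gamma>. E t \<Gamma> \<and> E s \<Gamma>)) \<le> P * (\<mu> + r)" if "t \<in> T" for t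
  proof -
    obtain i j k where t: "t = (i, j, k)" "i < n" "j < n" "k < n" using \<open>t \<in> T\<close> by (auto simp: T_def)
    have "(\<Sum>s\<in>T. proportion ?G (\<lambda>\<Gamma>. E t \<Gamma> \<and> E s \<Gamma>))
      \<le> (\<Sum>(i', j', k')\<in>T. P * (P + of_bool (i = i' \<and> j = j') * (p * q)
           + of_bool (i = i' \<and> k = k') * (p * q)
           + of_bool (j = j' \<and> k = k') * (p * p) + of_bool (i = i' \<and> j = j' \<and> k = k')))"
      using t pEE by (intro sum_mono) (auto simp: T_def)
    also have "\<dots> = (\<Sum>i'<n. \<Sum>j'<n. \<Sum>k'<n. P * (P + of_bool (i = i') * (of_bool (j = j') * (p * q))
           + of_bool (i = i') * (of_bool (k = k') * (p * q))
           + of_bool (j = j') * (of_bool (k = k') * (p * p))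
           + of_bool (i = i') * (of_bool (j = j') * of_bool (k = k'))))"
      by (simp add: T_def sum.cartesian_product of_bool_conj mult.assoc)
    also have "\<dots> = P * (\<mu> + r)"
      using t by (simp add: sum.distrib \<mu>_def r_def power3_eq_cube of_bool_def sum.delta algebra_simps
          flip: sum_distrib_left cong: if_cong)
    finally show ?thesis .
  qed
  then have "(\<Sum>t\<in>T. \<Sum>s\<in>T. proportion ?G (\<lambda>\<Gamma>. E t \<Gamma> \<and> E s \<Gamma>)) \<le> (\<Sum>t\<in>T. P * (\<mu> + r))"
    by (rule sum_mono)
  also have "\<dots> = \<mu> * (\<mu> + r)" by (simp add: T_def \<mu>_def power3_eq_cube)
  finally have "(\<Sum>t\<in>T. \<Sum>s\<in>T. proportion ?G (\<lambda>\<Gamma>. E t \<Gamma> \<and> E s \<Gamma>)) \<le> \<mu> * (\<mu> + r)" .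
  moreover have "proportion ?G (\<lambda>\<Gamma>. \<forall>t\<in>T. \<not> E t \<Gamma>) * \<mu>\<^sup>2
      \<le> (\<Sum>t\<in>T. \<Sum>s\<in>T. proportion ?G (\<lambda>\<Gamma>. E t \<Gamma> \<and> E s \<Gamma>)) - \<mu>\<^sup>2"
    using second_moment[OF _ fT, of ?G E] finite_graphs M \<mu> by simp
  ultimately have "(proportion ?G (\<lambda>\<Gamma>. \<forall>t\<in>T. \<not> E t \<Gamma>) * \<mu>) * \<mu> \<le> r * \<mu>"
    by (simp add: algebra_simps power2_eq_square)
  moreover have \<mu>0: "\<mu> > 0" using P n by (simp add: \<mu>_def)
  ultimately have "proportion ?G (\<lambda>\<Gamma>. \<forall>t\<in>T. \<not> E t \<Gamma>) \<le> r / \<mu>"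
    by (simp add: field_simps)
  moreover have "proportion ?G (\<lambda>\<Gamma>. two_dimensional \<Gamma>) \<le> proportion ?G (\<lambda>\<Gamma>. \<forall>t\<in>T. \<not> E t \<Gamma>)"
  proof (rule proportion_mono)
    show "finite ?G" using M by (intro finite_graphs) simp
    fix \<Gamma> assume "\<Gamma> \<in> ?G" "two_dimensional \<Gamma>"
    then show "\<forall>t\<in>T. \<not> E t \<Gamma>"
      unfolding T_def E_def using not_two_dimensional_if_triangle[OF _ n(1)] by fast
  qed
  moreover have "r / \<mu> \<le> 3 * (real M ^ 2 / real n ^ 3) + 1 / n + 2 / real n ^ 2"
  proof -
    have n0: "real n > 0" using n by simp
    have "r / \<mu> = 2 * (M / n ^ 2) + (1 / q) * (1 / n ^ 2 + real M ^ 2 / n ^ 3)"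
      using n0 pq M unfolding r_def \<mu>_def P_def p_def
      by (simp add: field_simps power2_eq_square power3_eq_cube)
    also have "\<dots> \<le> 2 * (M / n ^ 2) + 2 * (1 / n ^ 2 + real M ^ 2 / n ^ 3)"
      using pq by (intro add_left_mono mult_right_mono) (auto simp: field_simps)
    \<comment> \<open>The mean inequality removes the mixed term, so that only \<open>M\<^sup>2 / n\<^sup>3\<close> has to be controlled.\<close>
    also have "2 * (M / n ^ 2) \<le> real M ^ 2 / n ^ 3 + 1 / n"
    proof -
      have "real M ^ 2 / n ^ 3 + 1 / n - 2 * (M / n ^ 2) = (real M - n)\<^sup>2 / n ^ 3"
        using n0 by (simp add: field_simps power2_eq_square power3_eq_cube)
      also have "\<dots> \<ge> 0" by simp
      finally show ?thesis by simp
    qed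
    finally show ?thesis by simp
  qed
  ultimately show ?thesis by linarith
qed

section \<open>The threshold\<close>

lemma asymptotically_almost_surelyI:
  assumes "filterlim f at_top sequentially" "b \<longlonglongrightarrow> 0"
    and "\<forall>\<^sub>F N in sequentially. proportion (graphs N (f N)) (\<lambda>\<Gamma>. \<not> Q \<Gamma>) \<le> b N"
  shows "asymptotically_almost_surely f Q"
proof -
  have "(\<lambda>N. proportion (graphs N (f N)) (\<lambda>\<Gamma>. \<not> Q \<Gamma>)) \<longlonglongrightarrow> 0"
    by (rule tendsto_sandwich[OF _ assms(3) tendsto_const assms(2)]) (simp add: proportion_nonneg)
  then have "(\<lambda>N. 1 - proportion (graphs N (f N)) (\<lambda>\<Gamma>. \<not> Q \<Gamma>)) \<longlonglongrightarrow> 1 - 0"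
    by (intro tendsto_intros)
  moreover have "\<forall>\<^sub>F N in sequentially. f N \<ge> 1"
    using assms(1) by (simp add: filterlim_at_top)
  then have "\<forall>\<^sub>F N in sequentially. 1 - proportion (graphs N (f N)) (\<lambda>\<Gamma>. \<not> Q \<Gamma>)
      = proportion (graphs N (f N)) Q"
    by eventually_elim (simp add: proportion_not finite_graphs)
  ultimately show ?thesis
    unfolding asymptotically_almost_surely_def proportion_def[symmetric]
    by (simp cong: filterlim_cong add: tendsto_cong)
qed

lemma powr_three_halves_squared: "(real N powr (3/2))\<^sup>2 = real N ^ 3"
proof (cases "N = 0")
  case False
  then have "(real N powr (3/2))\<^sup>2 = real N powr 3" by (simp add: powr_powr flip: powr_numeral)
  then show ?thesis using False by (simp add: powr_numeral)
qed simp

theorem theorem1p3: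
  fixes f :: "nat \<Rightarrow> nat"
  assumes "mono f"
    and "filterlim f at_top sequentially"
  shows "(dominates (\<lambda>N. real (f N)) (\<lambda>N. real N powr (3/2)) \<longrightarrow>
            asymptotically_almost_surely f (\<lambda>\<Gamma>. two_dimensional \<Gamma>)) \<and>
         (dominated_by (\<lambda>N. real (f N)) (\<lambda>N. real N powr (3/2)) \<longrightarrow>
            asymptotically_almost_surely f (\<lambda>\<Gamma>. \<not> two_dimensional \<Gamma>))"
proof (intro conjI impI)
  have f2: "\<forall>\<^sub>F N in sequentially. f N \<ge> 2"
    using assms(2) by (simp add: filterlim_at_top)
  {
    assume "dominates (\<lambda>N. real (f N)) (\<lambda>N. real N powr (3/2))"
    then have "(\<lambda>N. inverse (real (f N) / real N powr (3/2))) \<longlonglongrightarrow> 0"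
      unfolding dominates_def by (rule tendsto_inverse_0_at_top)
    then have "(\<lambda>N. 16 * (inverse (real (f N) / real N powr (3/2)))\<^sup>2) \<longlonglongrightarrow> 16 * 0\<^sup>2"
      by (intro tendsto_intros)
    moreover have eq: "16 * (inverse (real (f N) / real N powr (3/2)))\<^sup>2 = 16 * real N ^ 3 / real (f N) ^ 2" for N
      by (simp add: power_divide powr_three_halves_squared)
    ultimately have "(\<lambda>N. 16 * real N ^ 3 / real (f N) ^ 2) \<longlonglongrightarrow> 0"
      unfolding eq by simp
    then show "asymptotically_almost_surely f (\<lambda>\<Gamma>. two_dimensional \<Gamma>)"
    proof (rule asymptotically_almost_surelyI[OF assms(2)])
      show "\<forall>\<^sub>F N in sequentially. proportion (graphs N (f N)) (\<lambda>\<Gamma>. \<not> two_dimensional \<Gamma>)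
          \<le> 16 * real N ^ 3 / real (f N) ^ 2"
        using f2 by eventually_elim (rule proportion_not_two_dimensional_le, simp)
    qed
  }
  {
    assume "dominated_by (\<lambda>N. real (f N)) (\<lambda>N. real N powr (3/2))"
    then have "(\<lambda>N. inverse (real N powr (3/2) / real (f N))) \<longlonglongrightarrow> 0"
      unfolding dominates_def by (rule tendsto_inverse_0_at_top)
    then have "(\<lambda>N. (inverse (real N powr (3/2) / real (f N)))\<^sup>2) \<longlonglongrightarrow> 0\<^sup>2"
      by (intro tendsto_intros)
    moreover have eq: "(inverse (real N powr (3/2) / real (f N)))\<^sup>2 = real (f N) ^ 2 / real N ^ 3" for N
      by (simp add: power_divide powr_three_halves_squared)
    ultimately have "(\<lambda>N. real (f N) ^ 2 / real N ^ 3) \<longlonglongrightarrow> 0"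
      unfolding eq by simp
    then have "(\<lambda>N. 3 * (125 * (real (f N) ^ 2 / real N ^ 3)) + 5 * (1 / real N) + 50 * (1 / real N)\<^sup>2)
        \<longlonglongrightarrow> 3 * (125 * 0) + 5 * 0 + 50 * 0\<^sup>2"
      using lim_inverse_n' by (intro tendsto_intros)
    then have "(\<lambda>N. 3 * (125 * (real (f N) ^ 2 / real N ^ 3)) + 5 * (1 / real N) + 50 * (1 / real N)\<^sup>2) \<longlonglongrightarrow> 0"
      by simp
    then show "asymptotically_almost_surely f (\<lambda>\<Gamma>. \<not> two_dimensional \<Gamma>)"
    proof (rule asymptotically_almost_surelyI[OF assms(2)])
      show "\<forall>\<^sub>F N in sequentially. proportion (graphs N (f N)) (\<lambda>\<Gamma>. \<not> \<not> two_dimensional \<Gamma>)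
          \<le> 3 * (125 * (real (f N) ^ 2 / real N ^ 3)) + 5 * (1 / real N) + 50 * (1 / real N)\<^sup>2"
        using f2 eventually_ge_at_top[of 3]
      proof eventually_elim
        case (elim N)
        define n where "n = N div 3"
        have n: "3 * n \<le> N" "n \<ge> 1" "N \<le> 5 * n"
          unfolding n_def using elim(2) by presburger+
        \<comment> \<open>From \<open>N \<ge> 3\<close> on, \<open>N div 3\<close> is at least \<open>N / 5\<close>; the extreme case is \<open>N = 5\<close>.\<close>
        have inv: "1 / real n \<le> 5 / real N" using n elim by (simp add: field_simps)
        have "proportion (graphs N (f N)) (\<lambda>\<Gamma>. \<not> \<not> two_dimensional \<Gamma>)
            \<le> 3 * (real (f N) ^ 2 * (1 / real n) ^ 3) + 1 / real n + 2 * (1 / real n)\<^sup>2"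
          using proportion_triangle_free_le[OF n(1,2) elim(1)] by (simp add: power_divide)
        also have "\<dots> \<le> 3 * (real (f N) ^ 2 * (5 / real N) ^ 3) + 5 / real N + 2 * (5 / real N)\<^sup>2"
          using inv by (intro add_mono mult_left_mono power_mono) auto
        finally show ?case by (simp add: power_divide)
      qed
    qed
  }
qed

end
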